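(* Let $M$ be a length metric space and let $p\in M$. Let $T\subset M$ be an open neighborhood of $p$ and let $A\subset\mathbb R^n$ be an open neighborhood of $0$. Consider a mapping $E\colon T\times A\to M$ such that (1) $E$ is continuous, (2) $E(q,0)=q$ for every $q\in T$, (3) the mapping $E(q,\cdot)\colon A\to E(q,A)$ is a homeomorphism for every $q\in T$. Then there exist a bounded open neighborhood $V\subset A$ of $0$ and an open neighborhood $U\subset T$ of $p$ such that the function $$U\ni q\mapsto R(q)=\sup\{t>0:\ B(q,t)\subset E(q,V)\}\in(0,+\infty)$$ is well defined and lower semicontinuous. In particular, there exist $r_0>0$ and $\varepsilon_0>0$ such that $B(q,r_0)\subset E(q,V)$ for every $q\in B(p,\varepsilon_0)$.
   Context: A length metric space is a metric space in which the distance between any two points equals the infimum of the lengths of the continuous curves joining them. $B(q,t)$ denotes the open metric ball of center $q$ and radius $t$ in $M$, and $E(q,V)=\{E(q,x):x\in V\}$.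
   Formalization: Added: E(p,A) is a neighborhood of p in M (and n ≥ 1). Without it the claim fails, e.g. M = T = the plane, n = 1, A = ℝ, E(q,x) = q + x, where E(q,V) contains no ball; the conclusion itself implies this condition. *)

theory Defs
  imports "HOL-Analysis.Analysis"
begin

text \<open>The length of a curve on \<open>[0,1]\<close>: the supremum over all finite partitions
  (given as sorted lists) of the lengths of the inscribed polygons, possibly \<open>\<infinity>\<close>.\<close>

definition curve_length :: "(real \<Rightarrow> 'a::metric_space) \<Rightarrow> ereal" where
  "curve_length g =
     (SUP ts \<in> {ts. sorted ts \<and> set ts \<subseteq> {0..1}}.
        ereal (\<Sum>i<length ts - 1. dist (g (ts ! i)) (g (ts ! Suc i))))"

text \<open>The infimum of the empty set is \<open>\<infinity>\<close> in \<^typ>\<open>ereal\<close>, so any two points of a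
  length metric space are joined by curves of finite length.\<close>

class length_metric_space = metric_space +
  assumes dist_eq_Inf_curve_length:
    "ereal (dist x y) =
       (INF g \<in> {g. path g \<and> pathstart g = x \<and> pathfinish g = y}. curve_length g)"

definition lower_semicontinuous_on :: "'a::topological_space set \<Rightarrow> ('a \<Rightarrow> real) \<Rightarrow> bool" where
  "lower_semicontinuous_on U f \<longleftrightarrow>
     (\<forall>x\<in>U. \<forall>c<f x. eventually (\<lambda>y. c < f y) (at x within U))"

text \<open>The set of \<open>t > 0\<close> with \<open>B(q,t) \<subseteq> S\<close>. Its real supremum is meaningful only when the
  set is nonempty and bounded above, which has to be established separately.\<close>

definition inscribed_radii :: "'a::metric_space set \<Rightarrow> 'a \<Rightarrow> real set" where
  "inscribed_radii S q = {t. 0 < t \<and> ball q t \<subseteq> S}"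

end

theory Submission
  imports Defs
begin

text \<open>
  The hypothesis \<open>p \<in> interior (E(p,A))\<close> makes \<open>M\<close> an \<open>n\<close>-dimensional manifold near \<open>p\<close>, with
  \<open>E(p,\<cdot>)\<close> as a chart. Fix a small round ball \<open>V\<close> about \<open>0\<close> whose compact closure \<open>K\<close> is
  mapped by \<open>E(p,\<cdot>)\<close> into the domain of this chart; by compactness of \<open>K\<close> the same is true of
  \<open>E(q,\<cdot>)\<close> for \<open>q\<close> near \<open>p\<close>. Reading \<open>E(q,\<cdot>)\<close> in the chart and applying invariance of domain
  shows that \<open>E(q,V)\<close> is open in \<open>M\<close> (\<open>open_image_if_in_chart\<close>). It contains \<open>q = E(q,0)\<close>, so
  some ball about \<open>q\<close> is inscribed in it; the inscribed radii are bounded because \<open>E(q,\<cdot>)\<close> is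
  injective on \<open>K\<close>, so that the image of a boundary point of \<open>V\<close> is missed by \<open>E(q,V)\<close>.

  Lower semicontinuity is where the length structure enters. Balls of a length space are
  connected (\<open>connected_ball_length_space\<close>), and therefore a ball about \<open>q\<close> can leave the open
  set \<open>E(q,V)\<close> only through the boundary \<open>E(q,K - V)\<close>: it is inscribed as soon as its radius
  does not exceed the distance from \<open>q\<close> to \<open>E(q,K - V)\<close> (\<open>ball_subset_open_image\<close>). If
  \<open>B(q,t)\<close> is inscribed, this distance is at least \<open>t\<close>, and it varies continuously with \<open>q\<close>, since
  for \<open>q'\<close> near \<open>q\<close> the map \<open>E(q',\<cdot>)\<close> is uniformly close to \<open>E(q,\<cdot>)\<close> on the compact set \<open>K\<close>. Hence every radius \<open>s < t\<close> is
  inscribed at all points near \<open>q\<close> (\<open>inscribed_radii_stable\<close>).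
\<close>

section \<open>Balls in a length space\<close>

lemma dist_start_le_curve_length:
  assumes "u \<in> {0..1}"
  shows "ereal (dist (g 0) (g u)) \<le> curve_length g"
proof -
  have "ereal (\<Sum>i<length [0,u] - 1. dist (g ([0,u] ! i)) (g ([0,u] ! Suc i))) \<le> curve_length g"
    unfolding curve_length_def by (rule SUP_upper) (use assms in auto)
  then show ?thesis by simp
qed

text \<open>A curve from the center to a point of the ball may be chosen shorter than the radius, and
  then it cannot leave the ball.\<close>

lemma connected_ball_length_space:
  fixes q :: "'m::length_metric_space"
  shows "connected (ball q s)"
proof -
  have "\<exists>C. connected C \<and> C \<subseteq> ball q s \<and> q \<in> C \<and> y \<in> C" if "y \<in> ball q s" for y
  proof -
    have "(INF g \<in> {g. path g \<and> pathstart g = q \<and> pathfinish g = y}. curve_length g) < ereal s"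
      using that by (simp flip: dist_eq_Inf_curve_length)
    then obtain g where g: "path g" "pathstart g = q" "pathfinish g = y"
      and len: "curve_length g < ereal s"
      unfolding INF_less_iff by auto
    have "dist q (g u) < s" if "u \<in> {0..1}" for u
      using le_less_trans[OF dist_start_le_curve_length[OF that] len] g(2)
      by (simp add: pathstart_def)
    then have "path_image g \<subseteq> ball q s"
      by (auto simp: path_image_def)
    then show ?thesis
      using g connected_path_image pathstart_in_path_image pathfinish_in_path_image by metis
  qed
  then show ?thesis
    by (intro connected_iff_connected_component[THEN iffD2])
      (meson connected_component_def connected_component_sym connected_component_trans)
qed

text \<open>The part of the ball covered by \<open>f ` V\<close> is relatively open, and relatively closed as well,
  being the part covered by the compact set \<open>f ` K\<close>.\<close>

lemma ball_subset_open_image: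
  fixes q :: "'m::length_metric_space" and f :: "'b::topological_space \<Rightarrow> 'm"
  assumes "compact K" "continuous_on K f" "V \<subseteq> K" "open (f ` V)" "q \<in> f ` V"
    and far: "\<And>x. x \<in> K - V \<Longrightarrow> s \<le> dist q (f x)"
  shows "ball q s \<subseteq> f ` V"
proof (cases "0 < s")
  case True
  have "open (- f ` K)"
    using assms(1,2) by (simp add: compact_continuous_image compact_imp_closed open_Compl)
  moreover have "ball q s \<subseteq> f ` V \<union> - f ` K"
  proof
    fix y assume "y \<in> ball q s"
    then have "y \<noteq> f x" if "x \<in> K - V" for x
      using far[OF that] by auto
    then show "y \<in> f ` V \<union> - f ` K" by blast
  qed
  moreover have "f ` V \<inter> - f ` K \<inter> ball q s = {}"
    using assms(3) by auto
  moreover have "f ` V \<inter> ball q s \<noteq> {}"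
    using assms(5) True by auto
  ultimately show ?thesis
    using connectedD[OF connected_ball_length_space, of "f ` V" "- f ` K"] assms(4) by blast
qed (simp add: ball_empty)

section \<open>Images contained in a chart\<close>

text \<open>The inverse \<open>h\<close> of the chart turns \<open>g\<close> into the map \<open>h \<circ> g\<close> between subsets of the same
  Euclidean space, to which invariance of domain applies.\<close>

lemma open_image_if_in_chart:
  fixes f g :: "'a::euclidean_space \<Rightarrow> 'm::topological_space"
  assumes chart: "homeomorphism A (f ` A) f h"
    and "open V" "continuous_on V g" "inj_on g V"
    and sub: "g ` V \<subseteq> interior (f ` A)"
  shows "open (g ` V)"
proof -
  let ?W = "interior (f ` A)"
  have h: "continuous_on ?W h" "inj_on h ?W"
    using homeomorphism_cont2[OF chart] interior_subset continuous_on_subset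
     apply blast
    by (metis chart homeomorphism_apply2 inj_on_inverseI interior_subset subsetD)
  have "continuous_on V (h \<circ> g)"
    using assms(3) h(1) sub continuous_on_compose continuous_on_subset by blast
  moreover have "inj_on (h \<circ> g) V"
    using assms(4) h(2) sub comp_inj_on inj_on_subset by blast
  ultimately have "open ((h \<circ> g) ` V)"
    using invariance_of_domain \<open>open V\<close> by blast
  then have "open (?W \<inter> h -` ((h \<circ> g) ` V))"
    using continuous_open_preimage[OF h(1)] by blast
  moreover have "?W \<inter> h -` ((h \<circ> g) ` V) = g ` V"
    using sub h(2) by (auto dest: inj_onD)
  ultimately show ?thesis by simp
qed

text \<open>The compact set \<open>E(p,K)\<close> has a uniform neighborhood inside \<open>W\<close>, and \<open>E(q,\<cdot>)\<close> is uniformly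
  close to \<open>E(p,\<cdot>)\<close> on \<open>K\<close> for \<open>q\<close> near \<open>p\<close>.\<close>

lemma image_in_open_stable:
  fixes E :: "'a::topological_space \<times> 'b::topological_space \<Rightarrow> 'm::metric_space"
  assumes "open T" "compact K" "continuous_on (T \<times> K) E" "p \<in> T"
    and "open W" "(\<lambda>x. E (p, x)) ` K \<subseteq> W"
  obtains U where "open U" "p \<in> U" "U \<subseteq> T" "\<And>q. q \<in> U \<Longrightarrow> (\<lambda>x. E (q, x)) ` K \<subseteq> W"
proof -
  have "continuous_on K (\<lambda>x. E (p, x))"
    using assms(3,4) by (auto intro!: continuous_on_compose2[OF assms(3)] continuous_intros)
  then have "compact ((\<lambda>x. E (p, x)) ` K)"
    using assms(2) compact_continuous_image by blast
  then obtain e where e: "e > 0" "(\<Union>y\<in>(\<lambda>x. E (p, x)) ` K. ball y e) \<subseteq> W"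
    using compact_subset_open_imp_ball_epsilon_subset assms(5,6) by blast
  then obtain X where X: "p \<in> X" "open X"
    "\<forall>q\<in>X \<inter> T. \<forall>x\<in>K. dist (E (q, x)) (E (p, x)) \<le> e/2"
    using continuous_on_prod_compactE[OF assms(3,2,4), of "e/2"] by (metis half_gt_zero)
  have "(\<lambda>x. E (q, x)) ` K \<subseteq> W" if "q \<in> X \<inter> T" for q
  proof
    fix y assume "y \<in> (\<lambda>x. E (q, x)) ` K"
    then obtain x where x: "x \<in> K" "y = E (q, x)" by blast
    then have "dist y (E (p, x)) \<le> e/2"
      using X(3) that by blast
    then have "dist (E (p, x)) y < e"
      using e(1) by (simp add: dist_commute)
    then have "y \<in> (\<Union>y\<in>(\<lambda>x. E (p, x)) ` K. ball y e)"
      using x(1) by auto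
    then show "y \<in> W" using e(2) by blast
  qed
  then show ?thesis
    using that[of "X \<inter> T"] X(1,2) assms(1,4) by auto
qed

section \<open>Inscribed radii\<close>

text \<open>Since \<open>E(q,x)\<close> with \<open>x \<in> K - V\<close> lies outside \<open>E(q,V)\<close>, its distance from \<open>q\<close> bounds the
  inscribed radii.\<close>

lemma inscribed_radius_le_dist:
  assumes "inj_on f K" "V \<subseteq> K" "x \<in> K - V" "t \<in> inscribed_radii (f ` V) q"
  shows "t \<le> dist q (f x)"
proof -
  have "f x \<notin> f ` V"
    using assms(1-3) by (auto dest: inj_onD)
  then have "f x \<notin> ball q t"
    using assms(4) by (auto simp: inscribed_radii_def)
  then show ?thesis by simp
qed

lemma inscribed_radii_stable:
  fixes E :: "'m::length_metric_space \<times> 'b::topological_space \<Rightarrow> 'm"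
  assumes "open U" "compact K" "continuous_on (U \<times> K) E" "V \<subseteq> K"
    and inj: "\<And>q. q \<in> U \<Longrightarrow> inj_on (\<lambda>x. E (q, x)) K"
    and op: "\<And>q. q \<in> U \<Longrightarrow> open ((\<lambda>x. E (q, x)) ` V)"
    and center: "\<And>q. q \<in> U \<Longrightarrow> q \<in> (\<lambda>x. E (q, x)) ` V"
    and "q \<in> U" "t \<in> inscribed_radii ((\<lambda>x. E (q, x)) ` V) q" "0 < s" "s < t"
  shows "eventually (\<lambda>q'. s \<in> inscribed_radii ((\<lambda>x. E (q', x)) ` V) q') (nhds q)"
proof -
  \<comment> \<open>Moving both endpoints of a segment by at most \<open>e\<close> shortens it by at most \<open>t - s\<close>.\<close>
  define e where "e = (t - s) / 2"
  have "e > 0" using \<open>s < t\<close> by (simp add: e_def)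
  then obtain X where X: "q \<in> X" "open X"
    "\<forall>q'\<in>X \<inter> U. \<forall>x\<in>K. dist (E (q', x)) (E (q, x)) \<le> e"
    using continuous_on_prod_compactE[OF assms(3,2) \<open>q \<in> U\<close>] by metis
  have "s \<in> inscribed_radii ((\<lambda>x. E (q', x)) ` V) q'" if q': "q' \<in> X \<inter> U \<inter> ball q e" for q'
  proof -
    have "s \<le> dist q' (E (q', x))" if x: "x \<in> K - V" for x
    proof -
      have "t \<le> dist q (E (q, x))"
        using inscribed_radius_le_dist[OF inj[OF \<open>q \<in> U\<close>] \<open>V \<subseteq> K\<close> x assms(9)] .
      also have "\<dots> \<le> dist q q' + dist q' (E (q', x)) + dist (E (q', x)) (E (q, x))"
        by metric
      finally have "t \<le> dist q q' + dist q' (E (q', x)) + dist (E (q', x)) (E (q, x))" .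
      moreover have "dist (E (q', x)) (E (q, x)) \<le> e" "dist q q' < e"
        using X(3) q' x by auto
      ultimately show ?thesis
        by (simp add: e_def)
    qed
    moreover have "continuous_on K (\<lambda>x. E (q', x))"
      using q' by (auto intro!: continuous_on_compose2[OF assms(3)] continuous_intros)
    ultimately have "ball q' s \<subseteq> (\<lambda>x. E (q', x)) ` V"
      using q' op center \<open>compact K\<close> \<open>V \<subseteq> K\<close> by (intro ball_subset_open_image[of K]) auto
    then show ?thesis using \<open>0 < s\<close> by (simp add: inscribed_radii_def)
  qed
  then show ?thesis
    unfolding eventually_nhds
    using X(1,2) \<open>open U\<close> \<open>q \<in> U\<close> \<open>e > 0\<close>
    by (intro exI[of _ "X \<inter> U \<inter> ball q e"]) auto
qed

text \<open>The supremum inherits lower semicontinuity from the stability of each single radius.\<close>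

lemma lower_semicontinuous_on_Sup:
  fixes r :: "'a::topological_space \<Rightarrow> real set"
  assumes ne: "\<And>q. q \<in> U \<Longrightarrow> r q \<noteq> {}" and bdd: "\<And>q. q \<in> U \<Longrightarrow> bdd_above (r q)"
    and pos: "\<And>q t. q \<in> U \<Longrightarrow> t \<in> r q \<Longrightarrow> 0 < t"
    and stable: "\<And>q s t. q \<in> U \<Longrightarrow> t \<in> r q \<Longrightarrow> 0 < s \<Longrightarrow> s < t \<Longrightarrow>
      eventually (\<lambda>q'. s \<in> r q') (nhds q)"
  shows "lower_semicontinuous_on U (\<lambda>q. Sup (r q))"
  unfolding lower_semicontinuous_on_def
proof (intro ballI allI impI)
  fix q c assume q: "q \<in> U" and "c < Sup (r q)"
  then obtain t where t: "t \<in> r q" "c < t"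
    using less_cSup_iff[OF ne bdd] by blast
  then obtain s where s: "max 0 c < s" "s < t"
    using dense[of "max 0 c" t] pos[OF q] by auto
  have "eventually (\<lambda>y. s \<in> r y) (at q within U)"
    using stable[OF q t(1), of s] s
    unfolding eventually_at_filter by (auto elim!: eventually_mono)
  moreover have "eventually (\<lambda>y. y \<in> U) (at q within U)"
    by (simp add: eventually_at_filter)
  ultimately show "eventually (\<lambda>y. c < Sup (r y)) (at q within U)"
  proof eventually_elim
    case (elim y)
    then have "s \<le> Sup (r y)" using bdd by (intro cSup_upper)
    then show ?case using s by simp
  qed
qed

section \<open>Lower semicontinuity of the inscribed radius\<close>

theorem theorem1p5:
  fixes p :: "'m::length_metric_space"
    and T :: "'m set"
    and A :: "(real ^ 'n) set"
    and E :: "'m \<times> (real ^ 'n) \<Rightarrow> 'm"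
  assumes "open T" and "p \<in> T"
    and "open A" and "0 \<in> A"
    and "continuous_on (T \<times> A) E"
    and "\<And>q. q \<in> T \<Longrightarrow> E (q, 0) = q"
    and "\<And>q. q \<in> T \<Longrightarrow> \<exists>h. homeomorphism A ((\<lambda>x. E (q, x)) ` A) (\<lambda>x. E (q, x)) h"
    and "p \<in> interior ((\<lambda>x. E (p, x)) ` A)"
  shows "\<exists>V U.
           open V \<and> bounded V \<and> 0 \<in> V \<and> V \<subseteq> A \<and>
           open U \<and> p \<in> U \<and> U \<subseteq> T \<and>
           (let radii = (\<lambda>q. inscribed_radii ((\<lambda>x. E (q, x)) ` V) q);
                R = (\<lambda>q. Sup (radii q))
            in (\<forall>q\<in>U. radii q \<noteq> {} \<and> bdd_above (radii q) \<and> 0 < R q) \<and>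
               lower_semicontinuous_on U R) \<and>
           (\<exists>r\<^sub>0>0. \<exists>\<epsilon>\<^sub>0>0. ball p \<epsilon>\<^sub>0 \<subseteq> T \<and>
              (\<forall>q\<in>ball p \<epsilon>\<^sub>0. ball q r\<^sub>0 \<subseteq> (\<lambda>x. E (q, x)) ` V))"
proof -
  let ?E = "\<lambda>q x. E (q, x)"
  let ?W = "interior (?E p ` A)"
  have contE: "continuous_on A (?E q)" if "q \<in> T" for q
    using that by (auto intro!: continuous_on_compose2[OF assms(5)] continuous_intros)
  have inj: "inj_on (?E q) A" if "q \<in> T" for q
    using assms(7)[OF that] by (metis homeomorphism_apply1 inj_on_inverseI)
  obtain h where chart: "homeomorphism A (?E p ` A) (?E p) h"
    using assms(7)[OF \<open>p \<in> T\<close>] by blast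

  have "open (A \<inter> ?E p -` ?W)"
    using continuous_open_preimage[OF contE[OF \<open>p \<in> T\<close>] \<open>open A\<close>] by simp
  moreover have "0 \<in> A \<inter> ?E p -` ?W"
    using assms(4,6,8) \<open>p \<in> T\<close> by simp
  ultimately obtain d where d: "d > 0" "cball 0 d \<subseteq> A \<inter> ?E p -` ?W"
    using open_contains_cball by blast
  define V where "V = ball (0 :: real ^ 'n) d"
  define K where "K = cball (0 :: real ^ 'n) d"
  have VK: "open V" "bounded V" "0 \<in> V" "V \<subseteq> K" "compact K" "K \<subseteq> A"
    using d by (auto simp: V_def K_def)
  \<comment> \<open>The sphere is nonempty because an index type is nonempty, so that the dimension is positive.\<close>
  obtain b where b: "b \<in> K - V"
    using vector_choose_size[of d] d(1) by (auto simp: V_def K_def)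

  have contTK: "continuous_on (T \<times> K) E"
    using assms(5) by (rule continuous_on_subset) (use VK in auto)
  have "?E p ` K \<subseteq> ?W" using d(2) by (auto simp: K_def)
  then obtain U where U: "open U" "p \<in> U" "U \<subseteq> T" and UW: "\<And>q. q \<in> U \<Longrightarrow> ?E q ` K \<subseteq> ?W"
    using image_in_open_stable[OF \<open>open T\<close> VK(5) contTK \<open>p \<in> T\<close> open_interior] by metis
  have op: "open (?E q ` V)" if "q \<in> U" for q
  proof (rule open_image_if_in_chart[OF chart \<open>open V\<close>])
    show "continuous_on V (?E q)" "inj_on (?E q) V"
      using contE[of q] inj[of q] that U(3) VK by (meson continuous_on_subset inj_on_subset subsetD subset_trans)+
    show "?E q ` V \<subseteq> ?W"
      using UW[OF that] VK(4) by blast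
  qed
  have center: "q \<in> ?E q ` V" if "q \<in> U" for q
    using assms(6)[of q] that U(3) VK(3) by (metis image_eqI subsetD)
  have injK: "inj_on (?E q) K" if "q \<in> U" for q
    using inj[of q] that U(3) VK(6) inj_on_subset by blast

  define r where "r q = inscribed_radii (?E q ` V) q" for q
  have pos: "0 < t" if "t \<in> r q" for q t
    using that by (simp add: r_def inscribed_radii_def)
  have ne: "r q \<noteq> {}" if q: "q \<in> U" for q
  proof -
    obtain t where "0 < t" "ball q t \<subseteq> ?E q ` V"
      using open_contains_ball op[OF q] center[OF q] by metis
    then show ?thesis unfolding r_def inscribed_radii_def by blast
  qed
  have bdd: "bdd_above (r q)" if "q \<in> U" for q
    using inscribed_radius_le_dist[OF injK[OF that] VK(4) b] unfolding r_def
    by (intro bdd_aboveI)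
  have stable: "eventually (\<lambda>q'. s \<in> r q') (nhds q)"
    if "q \<in> U" "t \<in> r q" "0 < s" "s < t" for q s t
    using inscribed_radii_stable[OF U(1) VK(5) _ VK(4) injK op center, of q t s]
      continuous_on_subset[OF contTK, of "U \<times> K"] U(3) that
    unfolding r_def by blast
  have Sup_pos: "0 < Sup (r q)" if "q \<in> U" for q
    using ne[OF that] pos bdd[OF that] by (meson cSup_upper ex_in_conv less_le_trans)
  have lsc: "lower_semicontinuous_on U (\<lambda>q. Sup (r q))"
    by (rule lower_semicontinuous_on_Sup) (use ne bdd pos stable in auto)

  obtain t where t: "t \<in> r p" using ne[OF U(2)] by blast
  have "eventually (\<lambda>q. t/2 \<in> r q \<and> q \<in> U) (nhds p)"
    using stable[OF U(2) t, of "t/2"] pos[OF t] eventually_nhds_in_open[OF U(1,2)]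
    by (auto intro: eventually_conj)
  then obtain e where e: "e > 0" "\<And>q. q \<in> ball p e \<Longrightarrow> t/2 \<in> r q \<and> q \<in> U"
    by (auto simp: eventually_nhds_metric dist_commute)
  have "\<exists>r\<^sub>0>0. \<exists>\<epsilon>\<^sub>0>0. ball p \<epsilon>\<^sub>0 \<subseteq> T \<and> (\<forall>q\<in>ball p \<epsilon>\<^sub>0. ball q r\<^sub>0 \<subseteq> ?E q ` V)"
  proof (intro exI conjI)
    show "0 < t/2" using pos[OF t] by simp
    show "ball p e \<subseteq> T" using e(2) U(3) by blast
    show "\<forall>q\<in>ball p e. ball q (t/2) \<subseteq> ?E q ` V"
      using e(2) by (auto simp only: r_def inscribed_radii_def mem_Collect_eq)
  qed (use e in simp)
  then show ?thesis
    unfolding Let_def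
    using VK U ne bdd Sup_pos lsc unfolding r_def
    by (intro exI[of _ V] exI[of _ U]) auto
qed

end
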